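(* (Gauss theorem.) Let $(M,g)$ be a smooth Riemannian manifold with Levi-Civita connection $\nabla$, and let $\mathcal{D}\subseteq TM$ be a regular distribution. For all $X_1,X_2,X_3,X_4\in\Gamma(\mathcal{D})$, $$\mathrm{K}^{\mathcal{D}}(X_1,X_2,X_3,X_4)=\mathrm{K}(X_1,X_2,X_3,X_4)-g(B(X_1,X_3),B(X_2,X_4))+g(B(X_2,X_3),B(X_1,X_4))+g\big(\pi^{\mathcal{D}}(\nabla_{[X_1,X_2]^{\mathcal{D}^{\bot}}}X_3),X_4\big).$$
   Context: All objects are $\mathcal{C}^\infty$. A regular distribution is a smooth subbundle of $TM$ of constant rank; $\mathcal{D}^{\bot}$ is the $g$-orthogonal complement of $\mathcal{D}$; $\Gamma(\cdot)$ denotes smooth sections; $\pi^{\mathcal{D}},\pi^{\mathcal{D}^{\bot}}$ are the orthogonal projections of $TM$ onto $\mathcal{D}$ and $\mathcal{D}^{\bot}$. For $X,Y\in\Gamma(\mathcal{D})$: $\nabla^{\mathcal{D}}_XY=\pi^{\mathcal{D}}(\nabla_XY)$, $[X,Y]^{\mathcal{D}}=\pi^{\mathcal{D}}([X,Y])$, $[X,Y]^{\mathcal{D}^{\bot}}=\pi^{\mathcal{D}^{\bot}}([X,Y])$, and $B(X,Y)=\pi^{\mathcal{D}^{\bot}}(\nabla_XY)$ (second fundamental form). For $X_1,\dots,X_4\in\Gamma(\mathcal{D})$ the curvature tensors are $$\mathrm{K}(X_1,X_2,X_3,X_4)=g(\nabla_{X_1}\nabla_{X_2}X_3-\nabla_{X_2}\nabla_{X_1}X_3-\nabla_{[X_1,X_2]}X_3,X_4),$$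 $$\mathrm{K}^{\mathcal{D}}(X_1,X_2,X_3,X_4)=g(\nabla^{\mathcal{D}}_{X_1}\nabla^{\mathcal{D}}_{X_2}X_3-\nabla^{\mathcal{D}}_{X_2}\nabla^{\mathcal{D}}_{X_1}X_3-\nabla^{\mathcal{D}}_{[X_1,X_2]^{\mathcal{D}}}X_3,X_4).$$ *)

theory Defs
  imports "HOL-Analysis.Analysis" "HOL-Library.Function_Algebras"
begin

text \<open>Tangent vectors are functionals, so they live in a function space; addition and zero are
  the pointwise ones of the library.\<close>

instantiation "fun" :: (type, real_vector) real_vector
begin

definition scaleR_fun :: "real \<Rightarrow> ('a \<Rightarrow> 'b) \<Rightarrow> 'a \<Rightarrow> 'b" where
  "scaleR_fun c f = (\<lambda>x. c *\<^sub>R f x)"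

instance
  by standard (auto simp: scaleR_fun_def fun_eq_iff algebra_simps)

end

text \<open>Meant for open \<open>S\<close> in a finite-dimensional domain, where being \<open>C^(n+1)\<close> amounts to being
  differentiable with all directional derivatives \<open>C^n\<close>.\<close>

primrec Ck_on :: "nat \<Rightarrow> 'a::real_normed_vector set \<Rightarrow> ('a \<Rightarrow> 'b::real_normed_vector) \<Rightarrow> bool"
where
  "Ck_on 0 S f \<longleftrightarrow> continuous_on S f"
| "Ck_on (Suc n) S f \<longleftrightarrow>
     (\<forall>x\<in>S. f differentiable (at x)) \<and>
     (\<forall>v. Ck_on n S (\<lambda>x. frechet_derivative f (at x) v))"

definition smooth_on :: "'a::real_normed_vector set \<Rightarrow> ('a \<Rightarrow> 'b::real_normed_vector) \<Rightarrow> bool" where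
  "smooth_on S f \<longleftrightarrow> (\<forall>n. Ck_on n S f)"

text \<open>A chart is a pair \<open>(U, \<phi>)\<close> of an open domain and a coordinate map; its inverse is
  \<open>inv_into U \<phi>\<close>. The values of \<open>\<phi>\<close> outside \<open>U\<close> are irrelevant.\<close>

type_synonym ('m, 'e) atlas = "('m set \<times> ('m \<Rightarrow> 'e)) set"

text \<open>The manifold is the whole type \<open>'m\<close>. The model space \<open>'e\<close> is any finite-dimensional normed
  space, rather than a type of class \<open>euclidean_space\<close>, because the latter has positive dimension.
  The atlas need not be maximal: every notion below depends only on the smooth structure it
  generates.\<close>

locale smooth_manifold =
  fixes A :: "('m::{t2_space, second_countable_topology}, 'e::real_normed_vector) atlas"
  assumes finite_dim: "\<exists>B::'e set. finite B \<and> span B = UNIV"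
    and cover: "(\<Union>(U, \<phi>)\<in>A. U) = UNIV"
    and open_domain: "(U, \<phi>) \<in> A \<Longrightarrow> open U"
    and open_codomain: "(U, \<phi>) \<in> A \<Longrightarrow> open (\<phi> ` U)"
    and chart: "(U, \<phi>) \<in> A \<Longrightarrow> homeomorphism U (\<phi> ` U) \<phi> (inv_into U \<phi>)"
    and compatible: "(U, \<phi>) \<in> A \<Longrightarrow> (V, \<psi>) \<in> A \<Longrightarrow>
      smooth_on (\<phi> ` (U \<inter> V)) (\<psi> \<circ> inv_into U \<phi>)"

definition smooth_fun_on ::
  "('m, 'e::real_normed_vector) atlas \<Rightarrow> 'm set \<Rightarrow> ('m \<Rightarrow> real) \<Rightarrow> bool" where
  "smooth_fun_on A W f \<longleftrightarrow> (\<forall>(U, \<phi>)\<in>A. smooth_on (\<phi> ` (U \<inter> W)) (f \<circ> inv_into U \<phi>))"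

definition smooth_funs :: "('m, 'e::real_normed_vector) atlas \<Rightarrow> ('m \<Rightarrow> real) set" where
  "smooth_funs A = {f. smooth_fun_on A UNIV f}"

type_synonym 'm tangent = "('m \<Rightarrow> real) \<Rightarrow> real"
type_synonym 'm vfield = "'m \<Rightarrow> 'm tangent"

text \<open>Derivations at \<open>p\<close> of the algebra of smooth functions. Outside that algebra they take the
  value 0, so that a derivation is represented by exactly one functional.\<close>

definition tangent_space ::
  "('m, 'e::real_normed_vector) atlas \<Rightarrow> 'm \<Rightarrow> 'm tangent set" where
  "tangent_space A p = {v.
     (\<forall>f. f \<notin> smooth_funs A \<longrightarrow> v f = 0) \<and>
     (\<forall>f\<in>smooth_funs A. \<forall>h\<in>smooth_funs A. v (\<lambda>x. f x + h x) = v f + v h) \<and>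
     (\<forall>c. \<forall>f\<in>smooth_funs A. v (\<lambda>x. c * f x) = c * v f) \<and>
     (\<forall>f\<in>smooth_funs A. \<forall>h\<in>smooth_funs A. v (\<lambda>x. f x * h x) = f p * v h + h p * v f)}"

text \<open>On an open \<open>W\<close> it is enough to test against globally defined smooth functions, since bump
  functions extend coordinate functions near any given point.\<close>

definition smooth_vfield_on ::
  "('m, 'e::real_normed_vector) atlas \<Rightarrow> 'm set \<Rightarrow> 'm vfield \<Rightarrow> bool" where
  "smooth_vfield_on A W X \<longleftrightarrow>
     (\<forall>p\<in>W. X p \<in> tangent_space A p) \<and>
     (\<forall>f\<in>smooth_funs A. smooth_fun_on A W (\<lambda>p. X p f))"

definition vfields :: "('m, 'e::real_normed_vector) atlas \<Rightarrow> 'm vfield set" where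
  "vfields A = {X. smooth_vfield_on A UNIV X}"

definition fun_smult :: "('m \<Rightarrow> real) \<Rightarrow> 'm vfield \<Rightarrow> 'm vfield" where
  "fun_smult f X = (\<lambda>p. f p *\<^sub>R X p)"

definition lie_bracket :: "'m vfield \<Rightarrow> 'm vfield \<Rightarrow> 'm vfield" where
  "lie_bracket X Y = (\<lambda>p f. X p (\<lambda>q. Y q f) - Y p (\<lambda>q. X q f))"

type_synonym 'm metric = "'m \<Rightarrow> 'm tangent \<Rightarrow> 'm tangent \<Rightarrow> real"

text \<open>Smoothness of the metric is tested on local vector fields, in particular on coordinate
  fields.\<close>

locale riemannian_manifold = smooth_manifold A
  for A :: "('m::{t2_space, second_countable_topology}, 'e::real_normed_vector) atlas" +
  fixes g :: "'m metric"
  assumes metric_add: "u \<in> tangent_space A p \<Longrightarrow> v \<in> tangent_space A p \<Longrightarrow>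
      w \<in> tangent_space A p \<Longrightarrow> g p (u + v) w = g p u w + g p v w"
    and metric_scale: "u \<in> tangent_space A p \<Longrightarrow> w \<in> tangent_space A p \<Longrightarrow>
      g p (c *\<^sub>R u) w = c * g p u w"
    and metric_sym: "u \<in> tangent_space A p \<Longrightarrow> w \<in> tangent_space A p \<Longrightarrow> g p u w = g p w u"
    and metric_pos: "u \<in> tangent_space A p \<Longrightarrow> u \<noteq> 0 \<Longrightarrow> g p u u > 0"
    and metric_smooth: "open W \<Longrightarrow> smooth_vfield_on A W X \<Longrightarrow> smooth_vfield_on A W Y \<Longrightarrow>
      smooth_fun_on A W (\<lambda>p. g p (X p) (Y p))"

text \<open>\<open>nabla X Y\<close> is the covariant derivative of \<open>Y\<close> along \<open>X\<close>; it is unconstrained on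
  arguments that are not smooth vector fields.\<close>

locale affine_connection =
  fixes A :: "('m, 'e::real_normed_vector) atlas"
    and nabla :: "'m vfield \<Rightarrow> 'm vfield \<Rightarrow> 'm vfield"
  assumes conn_closed: "X \<in> vfields A \<Longrightarrow> Y \<in> vfields A \<Longrightarrow> nabla X Y \<in> vfields A"
    and conn_add_left: "X \<in> vfields A \<Longrightarrow> X' \<in> vfields A \<Longrightarrow> Y \<in> vfields A \<Longrightarrow>
      nabla (X + X') Y = nabla X Y + nabla X' Y"
    and conn_smult_left: "f \<in> smooth_funs A \<Longrightarrow> X \<in> vfields A \<Longrightarrow> Y \<in> vfields A \<Longrightarrow>
      nabla (fun_smult f X) Y = fun_smult f (nabla X Y)"
    and conn_add_right: "X \<in> vfields A \<Longrightarrow> Y \<in> vfields A \<Longrightarrow> Y' \<in> vfields A \<Longrightarrow>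
      nabla X (Y + Y') = nabla X Y + nabla X Y'"
    and conn_leibniz: "f \<in> smooth_funs A \<Longrightarrow> X \<in> vfields A \<Longrightarrow> Y \<in> vfields A \<Longrightarrow>
      nabla X (fun_smult f Y) = fun_smult (\<lambda>p. X p f) Y + fun_smult f (nabla X Y)"

locale levi_civita = affine_connection A nabla
  for A :: "('m, 'e::real_normed_vector) atlas" and g :: "'m metric"
    and nabla :: "'m vfield \<Rightarrow> 'm vfield \<Rightarrow> 'm vfield" +
  assumes torsion_free: "X \<in> vfields A \<Longrightarrow> Y \<in> vfields A \<Longrightarrow>
      nabla X Y - nabla Y X = lie_bracket X Y"
    and metric_compatible: "X \<in> vfields A \<Longrightarrow> Y \<in> vfields A \<Longrightarrow> Z \<in> vfields A \<Longrightarrow>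
      X p (\<lambda>q. g q (Y q) (Z q)) = g p (nabla X Y p) (Z p) + g p (Y p) (nabla X Z p)"

text \<open>A smooth subbundle of constant rank \<open>k\<close>, given by its fibres: near every point there is a
  smooth local frame \<open>F 0, \<dots>, F (k - 1)\<close>, whose linear independence follows from \<open>dim (D p) = k\<close>.\<close>

definition regular_distribution ::
  "('m::topological_space, 'e::real_normed_vector) atlas \<Rightarrow> nat \<Rightarrow> ('m \<Rightarrow> 'm tangent set) \<Rightarrow> bool"
where
  "regular_distribution A k D \<longleftrightarrow>
     (\<forall>p. D p \<subseteq> tangent_space A p \<and> subspace (D p) \<and> dim (D p) = k) \<and>
     (\<forall>p. \<exists>W F. open W \<and> p \<in> W \<and>
        (\<forall>i<k. smooth_vfield_on A W (F i)) \<and>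
        (\<forall>q\<in>W. span ((\<lambda>i. F i q) ` {..<k}) = D q))"

definition sections ::
  "('m, 'e::real_normed_vector) atlas \<Rightarrow> ('m \<Rightarrow> 'm tangent set) \<Rightarrow> 'm vfield set" where
  "sections A D = {X \<in> vfields A. \<forall>p. X p \<in> D p}"

definition orth_compl ::
  "('m, 'e::real_normed_vector) atlas \<Rightarrow> 'm metric \<Rightarrow> ('m \<Rightarrow> 'm tangent set) \<Rightarrow>
   'm \<Rightarrow> 'm tangent set" where
  "orth_compl A g D p = {v \<in> tangent_space A p. \<forall>w\<in>D p. g p v w = 0}"

definition orth_proj ::
  "'m metric \<Rightarrow> ('m \<Rightarrow> 'm tangent set) \<Rightarrow> 'm vfield \<Rightarrow> 'm vfield" where
  "orth_proj g D X = (\<lambda>p. THE u. u \<in> D p \<and> (\<forall>w\<in>D p. g p (X p - u) w = 0))"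

definition dist_conn ::
  "'m metric \<Rightarrow> ('m vfield \<Rightarrow> 'm vfield \<Rightarrow> 'm vfield) \<Rightarrow> ('m \<Rightarrow> 'm tangent set) \<Rightarrow>
   'm vfield \<Rightarrow> 'm vfield \<Rightarrow> 'm vfield" where
  "dist_conn g nabla D X Y = orth_proj g D (nabla X Y)"

definition second_fund_form ::
  "('m, 'e::real_normed_vector) atlas \<Rightarrow> 'm metric \<Rightarrow> ('m vfield \<Rightarrow> 'm vfield \<Rightarrow> 'm vfield) \<Rightarrow>
   ('m \<Rightarrow> 'm tangent set) \<Rightarrow> 'm vfield \<Rightarrow> 'm vfield \<Rightarrow> 'm vfield" where
  "second_fund_form A g nabla D X Y = orth_proj g (orth_compl A g D) (nabla X Y)"

definition curvature ::
  "'m metric \<Rightarrow> ('m vfield \<Rightarrow> 'm vfield \<Rightarrow> 'm vfield) \<Rightarrow>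
   'm vfield \<Rightarrow> 'm vfield \<Rightarrow> 'm vfield \<Rightarrow> 'm vfield \<Rightarrow> 'm \<Rightarrow> real" where
  "curvature g nabla X1 X2 X3 X4 = (\<lambda>p.
     g p ((nabla X1 (nabla X2 X3) - nabla X2 (nabla X1 X3) - nabla (lie_bracket X1 X2) X3) p) (X4 p))"

definition dist_curvature ::
  "'m metric \<Rightarrow> ('m vfield \<Rightarrow> 'm vfield \<Rightarrow> 'm vfield) \<Rightarrow> ('m \<Rightarrow> 'm tangent set) \<Rightarrow>
   'm vfield \<Rightarrow> 'm vfield \<Rightarrow> 'm vfield \<Rightarrow> 'm vfield \<Rightarrow> 'm \<Rightarrow> real" where
  "dist_curvature g nabla D X1 X2 X3 X4 = (\<lambda>p.
     g p ((dist_conn g nabla D X1 (dist_conn g nabla D X2 X3)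
           - dist_conn g nabla D X2 (dist_conn g nabla D X1 X3)
           - dist_conn g nabla D (orth_proj g D (lie_bracket X1 X2)) X3) p) (X4 p))"

end

theory Submission
  imports Defs
begin

text \<open>The analytic point is that the projection of a smooth field onto a regular distribution is
  smooth, which Gram--Schmidt gives locally; so the connection may be applied to projected fields.
  The rest is algebra: split \<open>\<nabla>\<^sub>Y Z\<close> into its tangential part and \<open>B(Y, Z)\<close>, and
  differentiate \<open>g(B(Y, Z), W) = 0\<close> to turn \<open>g(\<nabla>\<^sub>X B(Y, Z), W)\<close> into
  \<open>- g(B(Y, Z), B(X, W))\<close>.\<close>

section \<open>Functions of class \<open>C\<^sup>k\<close>\<close>

text \<open>\<open>frechet_derivative\<close> at a point looks at values in a whole neighbourhood;
  on an open \<open>S\<close> agreement on \<open>S\<close> fixes the germ at each point, so the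
  derivatives agree and the induction continues with them.\<close>

lemma Ck_on_cong:
  assumes "open S" "\<And>x. x \<in> S \<Longrightarrow> f x = h x" "Ck_on n S f"
  shows "Ck_on n S h"
  using assms(2,3)
proof (induction n arbitrary: f h)
  case 0
  then show ?case by (simp cong: continuous_on_cong)
next
  case (Suc n)
  have deriv: "(h has_derivative frechet_derivative f (at x)) (at x)" if "x \<in> S" for x
  proof -
    have "(f has_derivative frechet_derivative f (at x)) (at x)"
      using Suc.prems(2) that by (simp add: frechet_derivative_works)
    then show ?thesis
      using has_derivative_transform_within_open[OF _ assms(1) that] Suc.prems(1) by blast
  qed
  have "frechet_derivative f (at x) = frechet_derivative h (at x)" if "x \<in> S" for x
    using frechet_derivative_at[OF deriv[OF that]] .
  then have "Ck_on n S (\<lambda>x. frechet_derivative h (at x) v)" for v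
    using Suc.IH[of "\<lambda>x. frechet_derivative f (at x) v"] Suc.prems(2) by simp
  moreover have "h differentiable (at x)" if "x \<in> S" for x
    using deriv[OF that] by (auto simp: differentiable_def)
  ultimately show ?case by simp
qed

text \<open>By uniqueness of the derivative, any derivative found by a calculus rule may stand in
  for the chosen \<open>frechet_derivative\<close>. The closure properties below are proved through
  this rule.\<close>

lemma Ck_on_Suc_I:
  assumes "open S" "\<And>x. x \<in> S \<Longrightarrow> (f has_derivative f' x) (at x)"
    and "\<And>v. Ck_on n S (\<lambda>x. f' x v)"
  shows "Ck_on (Suc n) S f"
proof -
  have eq: "f' x = frechet_derivative f (at x)" if "x \<in> S" for x
    using frechet_derivative_at[OF assms(2)[OF that]] .
  have "Ck_on n S (\<lambda>x. frechet_derivative f (at x) v)" for v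
    by (rule Ck_on_cong[OF assms(1) _ assms(3)[of v]]) (simp add: eq)
  moreover have "f differentiable (at x)" if "x \<in> S" for x
    using assms(2)[OF that] by (auto simp: differentiable_def)
  ultimately show ?thesis by simp
qed

lemma Ck_on_has_derivative:
  "Ck_on (Suc n) S f \<Longrightarrow> x \<in> S \<Longrightarrow> (f has_derivative frechet_derivative f (at x)) (at x)"
  by (simp add: frechet_derivative_works)

lemma Ck_on_SucD: "Ck_on (Suc n) S f \<Longrightarrow> Ck_on n S f"
proof (induction n arbitrary: f)
  case 0
  then show ?case
    by (auto intro!: continuous_at_imp_continuous_on differentiable_imp_continuous_within)
next
  case (Suc n)
  have "Ck_on n S (\<lambda>x. frechet_derivative f (at x) v)" for v
    using Suc.prems by (intro Suc.IH) simp
  then show ?case using Suc.prems by simp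
qed

lemma Ck_on_const: "open S \<Longrightarrow> Ck_on n S (\<lambda>x. c)"
proof (induction n arbitrary: c)
  case (Suc n)
  show ?case
    by (rule Ck_on_Suc_I[where f' = "\<lambda>_ _. 0"]) (use Suc in auto)
qed simp

lemma Ck_on_add:
  "open S \<Longrightarrow> Ck_on n S f \<Longrightarrow> Ck_on n S h \<Longrightarrow> Ck_on n S (\<lambda>x. f x + h x)"
proof (induction n arbitrary: f h)
  case 0
  then show ?case by (simp add: continuous_on_add)
next
  case (Suc n)
  show ?case
    by (rule Ck_on_Suc_I[OF Suc.prems(1) has_derivative_add[OF
          Ck_on_has_derivative[OF Suc.prems(2)] Ck_on_has_derivative[OF Suc.prems(3)]]])
      (use Suc in auto)
qed

lemma Ck_on_mult:
  fixes f h :: "'a::real_normed_vector \<Rightarrow> real"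
  shows "open S \<Longrightarrow> Ck_on n S f \<Longrightarrow> Ck_on n S h \<Longrightarrow> Ck_on n S (\<lambda>x. f x * h x)"
proof (induction n arbitrary: f h)
  case 0
  then show ?case by (simp add: continuous_on_mult)
next
  case (Suc n)
  have d: "Ck_on n S (\<lambda>x. frechet_derivative f (at x) v)"
    "Ck_on n S (\<lambda>x. frechet_derivative h (at x) v)" for v
    using Suc.prems by simp_all
  \<comment> \<open>The product rule leaves one factor undifferentiated in each summand, so
    \<open>f\<close> and \<open>h\<close> themselves are lowered to order \<open>n\<close> before
    the induction hypothesis applies.\<close>
  show ?case
    by (rule Ck_on_Suc_I[OF Suc.prems(1) has_derivative_mult[OF
          Ck_on_has_derivative[OF Suc.prems(2)] Ck_on_has_derivative[OF Suc.prems(3)]]])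
      (assumption | intro Ck_on_add Suc.IH d Suc.prems(1) Suc.prems(2,3)[THEN Ck_on_SucD])+
qed

lemma Ck_on_inverse:
  fixes f :: "'a::real_normed_vector \<Rightarrow> real"
  assumes "open S" "\<And>x. x \<in> S \<Longrightarrow> f x \<noteq> 0"
  shows "Ck_on n S f \<Longrightarrow> Ck_on n S (\<lambda>x. inverse (f x))"
proof (induction n)
  case 0
  then show ?case using assms by (simp add: continuous_on_inverse)
next
  case (Suc n)
  have d: "Ck_on n S (\<lambda>x. frechet_derivative f (at x) v)" for v
    using Suc.prems by simp
  \<comment> \<open>The derivative of \<open>1/f\<close> contains \<open>1/f\<close> again, one
    order lower; the induction hypothesis supplies exactly that order.\<close>
  have i: "Ck_on n S (\<lambda>x. inverse (f x))"
    using Suc.IH Ck_on_SucD[OF Suc.prems] .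
  have "((\<lambda>x. inverse (f x)) has_derivative
      (\<lambda>v. (-1) * ((inverse (f x) * frechet_derivative f (at x) v) * inverse (f x)))) (at x)"
    if "x \<in> S" for x
    using Deriv.has_derivative_inverse[OF assms(2)[OF that] Ck_on_has_derivative[OF Suc.prems that]]
    by simp
  then show ?case
    by (rule Ck_on_Suc_I[OF assms(1)])
      (intro Ck_on_mult Ck_on_const assms(1) i d | assumption)+
qed

lemma Ck_on_subset: "T \<subseteq> S \<Longrightarrow> Ck_on n S f \<Longrightarrow> Ck_on n T f"
  by (induction n arbitrary: f) (auto intro: continuous_on_subset)

text \<open>Differentiability is a condition at each point and continuity glues over open sets, so
  being C^k is a local property.\<close>

lemma Ck_on_Union:
  assumes "\<And>S. S \<in> F \<Longrightarrow> open S" "\<And>S. S \<in> F \<Longrightarrow> Ck_on n S f"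
  shows "Ck_on n (\<Union>F) f"
  using assms(2)
proof (induction n arbitrary: f)
  case 0
  then show ?case using continuous_on_open_Union[of F f] assms(1) by simp
next
  case (Suc n)
  have "Ck_on n (\<Union>F) (\<lambda>x. frechet_derivative f (at x) v)" for v
    by (rule Suc.IH) (use Suc.prems in simp)
  then show ?case using Suc.prems by auto
qed

section \<open>Smooth functions and fields on open subsets of a manifold\<close>

context smooth_manifold
begin

text \<open>A homeomorphism onto an open set carries relatively open sets to sets open in the model
  space. This gives the openness that the C^k lemmas require.\<close>

lemma open_chart_image:
  assumes "(U, \<phi>) \<in> A" "open W"
  shows "open (\<phi> ` (U \<inter> W))"
proof -
  have "openin (top_of_set (\<phi> ` U)) (\<phi> ` (U \<inter> W))"
    by (rule homeomorphism_imp_open_map[OF chart[OF assms(1)]]) (use assms(2) in auto)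
  then show ?thesis
    using open_codomain[OF assms(1)] openin_open_eq by blast
qed

lemma smooth_fun_on_const: "open W \<Longrightarrow> smooth_fun_on A W (\<lambda>x. c)"
  unfolding smooth_fun_on_def smooth_on_def comp_def
  by (auto intro!: Ck_on_const open_chart_image)

lemma smooth_fun_on_add:
  "open W \<Longrightarrow> smooth_fun_on A W f \<Longrightarrow> smooth_fun_on A W h \<Longrightarrow> smooth_fun_on A W (\<lambda>x. f x + h x)"
  unfolding smooth_fun_on_def smooth_on_def comp_def
  by (auto intro!: Ck_on_add open_chart_image)

lemma smooth_fun_on_mult:
  "open W \<Longrightarrow> smooth_fun_on A W f \<Longrightarrow> smooth_fun_on A W h \<Longrightarrow> smooth_fun_on A W (\<lambda>x. f x * h x)"
  unfolding smooth_fun_on_def smooth_on_def comp_def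
  by (auto intro!: Ck_on_mult open_chart_image)

lemma smooth_fun_on_inverse:
  assumes "open W" "smooth_fun_on A W f" "\<And>x. x \<in> W \<Longrightarrow> f x \<noteq> 0"
  shows "smooth_fun_on A W (\<lambda>x. inverse (f x))"
proof -
  have "f (inv_into U \<phi> y) \<noteq> 0" if "(U, \<phi>) \<in> A" "y \<in> \<phi> ` (U \<inter> W)" for U \<phi> y
    using that assms(3) homeomorphism_apply1[OF chart[OF that(1)]] by auto
  then have "Ck_on n (\<phi> ` (U \<inter> W)) (\<lambda>y. inverse (f (inv_into U \<phi> y)))"
    if "(U, \<phi>) \<in> A" for U \<phi> n
    using that assms(1,2) open_chart_image unfolding smooth_fun_on_def smooth_on_def comp_def
    by (intro Ck_on_inverse) auto
  then show ?thesis unfolding smooth_fun_on_def smooth_on_def comp_def by auto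
qed

lemma smooth_fun_on_cong:
  assumes "open W" "\<And>x. x \<in> W \<Longrightarrow> f x = h x" "smooth_fun_on A W f"
  shows "smooth_fun_on A W h"
proof -
  have "Ck_on n (\<phi> ` (U \<inter> W)) (h \<circ> inv_into U \<phi>)" if c: "(U, \<phi>) \<in> A" for U \<phi> n
  proof (rule Ck_on_cong[OF open_chart_image[OF c assms(1)]])
    show "Ck_on n (\<phi> ` (U \<inter> W)) (f \<circ> inv_into U \<phi>)"
      using assms(3) c unfolding smooth_fun_on_def smooth_on_def by auto
    show "(f \<circ> inv_into U \<phi>) y = (h \<circ> inv_into U \<phi>) y" if "y \<in> \<phi> ` (U \<inter> W)" for y
      using that assms(2) homeomorphism_apply1[OF chart[OF c]] by auto
  qed
  then show ?thesis unfolding smooth_fun_on_def smooth_on_def by auto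
qed

lemma smooth_fun_on_subset:
  assumes "V \<subseteq> W" "smooth_fun_on A W f"
  shows "smooth_fun_on A V f"
proof -
  have "Ck_on n (\<phi> ` (U \<inter> V)) (f \<circ> inv_into U \<phi>)" if "(U, \<phi>) \<in> A" for U \<phi> n
  proof (rule Ck_on_subset)
    show "\<phi> ` (U \<inter> V) \<subseteq> \<phi> ` (U \<inter> W)" using assms(1) by auto
    show "Ck_on n (\<phi> ` (U \<inter> W)) (f \<circ> inv_into U \<phi>)"
      using assms(2) that unfolding smooth_fun_on_def smooth_on_def by auto
  qed
  then show ?thesis unfolding smooth_fun_on_def smooth_on_def by auto
qed

lemma smooth_fun_on_locally:
  assumes "\<And>p. \<exists>W. open W \<and> p \<in> W \<and> smooth_fun_on A W f"
  shows "smooth_fun_on A UNIV f"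
proof -
  have "Ck_on n (\<phi> ` U) (f \<circ> inv_into U \<phi>)" if c: "(U, \<phi>) \<in> A" for U \<phi> n
  proof -
    \<comment> \<open>Taking all open sets on which \<open>f\<close> is smooth avoids choosing one
      for each point; their chart images cover the image of \<open>U\<close>.\<close>
    let ?F = "{\<phi> ` (U \<inter> W) | W. open W \<and> smooth_fun_on A W f}"
    have "\<phi> ` U = \<Union>?F"
    proof
      show "\<phi> ` U \<subseteq> \<Union>?F"
      proof
        fix y
        assume "y \<in> \<phi> ` U"
        then obtain p where p: "p \<in> U" "y = \<phi> p" by blast
        obtain W where "open W" "p \<in> W" "smooth_fun_on A W f"
          using assms by blast
        with p show "y \<in> \<Union>?F" by blast
      qed
    qed auto
    moreover have "Ck_on n (\<Union>?F) (f \<circ> inv_into U \<phi>)"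
      by (rule Ck_on_Union)
        (use c open_chart_image[OF c] in \<open>auto simp: smooth_fun_on_def smooth_on_def\<close>)
    ultimately show ?thesis by simp
  qed
  then show ?thesis unfolding smooth_fun_on_def smooth_on_def by auto
qed

section \<open>Tangent spaces and smooth vector fields\<close>

lemma subspace_tangent_space: "subspace (tangent_space A p)"
  unfolding subspace_def tangent_space_def scaleR_fun_def
  by (auto simp: algebra_simps)

text \<open>Inside the algebra of smooth functions this is homogeneity with factor 0, outside it the
  default value 0. It is what makes the derivative of an identically vanishing pairing
  vanish.\<close>

lemma tangent_zero_fun:
  assumes "v \<in> tangent_space A p"
  shows "v (\<lambda>x. 0) = 0"
proof (cases "(\<lambda>x. 0) \<in> smooth_funs A")
  case True
  moreover have "\<forall>c. \<forall>f\<in>smooth_funs A. v (\<lambda>x. c * f x) = c * v f"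
    using assms unfolding tangent_space_def by blast
  ultimately have "v (\<lambda>x. 0 * 0) = 0 * v (\<lambda>x. 0)"
    by (elim allE[of _ 0] bspec)
  then show ?thesis by simp
qed (use assms in \<open>auto simp: tangent_space_def\<close>)

lemma smooth_vfield_on_add:
  assumes "open W" "smooth_vfield_on A W X" "smooth_vfield_on A W Y"
  shows "smooth_vfield_on A W (\<lambda>p. X p + Y p)"
  using assms unfolding smooth_vfield_on_def
  by (auto intro!: smooth_fun_on_add subspace_add[OF subspace_tangent_space])

lemma smooth_vfield_on_scale:
  assumes "open W" "smooth_fun_on A W f" "smooth_vfield_on A W X"
  shows "smooth_vfield_on A W (\<lambda>p. f p *\<^sub>R X p)"
  using assms subspace_scale[OF subspace_tangent_space] unfolding smooth_vfield_on_def
  by (auto intro!: smooth_fun_on_mult simp: scaleR_fun_def)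

lemma smooth_vfield_on_diff:
  assumes "open W" "smooth_vfield_on A W X" "smooth_vfield_on A W Y"
  shows "smooth_vfield_on A W (\<lambda>p. X p - Y p)"
  using smooth_vfield_on_add[OF assms(1,2)
      smooth_vfield_on_scale[OF assms(1) smooth_fun_on_const[OF assms(1), of "-1"] assms(3)]]
  by simp

lemma smooth_vfield_on_subset:
  "V \<subseteq> W \<Longrightarrow> smooth_vfield_on A W X \<Longrightarrow> smooth_vfield_on A V X"
  unfolding smooth_vfield_on_def using smooth_fun_on_subset by blast

lemma vfields_diff: "X \<in> vfields A \<Longrightarrow> Y \<in> vfields A \<Longrightarrow> X - Y \<in> vfields A"
  using smooth_vfield_on_diff[OF open_UNIV, of X Y] by (simp add: vfields_def fun_diff_def)

lemma vfields_tangent: "X \<in> vfields A \<Longrightarrow> X p \<in> tangent_space A p"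
  by (simp add: vfields_def smooth_vfield_on_def)

text \<open>Tangency is checked at each point and smoothness is local, so a globally defined field
  may be compared with a different smooth model near each point. Projections are handled this way,
  since frames exist only locally.\<close>

lemma vfields_locally:
  assumes "\<And>p. \<exists>W Y. open W \<and> p \<in> W \<and> smooth_vfield_on A W Y \<and> (\<forall>q\<in>W. X q = Y q)"
  shows "X \<in> vfields A"
proof -
  have "X p \<in> tangent_space A p" for p
    using assms[of p] by (auto simp: smooth_vfield_on_def)
  moreover have "smooth_fun_on A UNIV (\<lambda>p. X p f)" if "f \<in> smooth_funs A" for f
  proof (rule smooth_fun_on_locally)
    fix p
    obtain W Y where W: "open W" "p \<in> W" "smooth_vfield_on A W Y" "\<forall>q\<in>W. X q = Y q"
      using assms by blast
    have "smooth_fun_on A W (\<lambda>p. X p f)"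
      by (rule smooth_fun_on_cong[OF W(1), of "\<lambda>p. Y p f"])
        (use W that in \<open>auto simp: smooth_vfield_on_def\<close>)
    then show "\<exists>W. open W \<and> p \<in> W \<and> smooth_fun_on A W (\<lambda>p. X p f)"
      using W by blast
  qed
  ultimately show ?thesis by (auto simp: vfields_def smooth_vfield_on_def)
qed

end

section \<open>Orthogonal projections\<close>

lemma regular_distributionD:
  assumes "regular_distribution A k D"
  shows "D p \<subseteq> tangent_space A p" "subspace (D p)" "dim (D p) = k"
  using assms by (auto simp: regular_distribution_def)

text \<open>If \<open>F i\<close> depended on its predecessors, dropping it would leave a spanning
  family of at most \<open>k - 1\<close> vectors for a space of dimension \<open>k\<close>.
  Independence from the predecessors is the form that Gram-Schmidt consumes.\<close>

lemma spanning_family_independent: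
  fixes F :: "nat \<Rightarrow> 'v::real_vector"
  assumes "dim (span (F ` {..<k})) = k" "i < k"
  shows "F i \<notin> span (F ` {..<i})"
proof
  assume "F i \<in> span (F ` {..<i})"
  \<comment> \<open>Removing the index rather than the vector gives the bound \<open>k - 1\<close>
    on the cardinality even if \<open>F\<close> repeats values.\<close>
  let ?S = "F ` ({..<k} - {i})"
  have "F ` {..<i} \<subseteq> ?S" using assms(2) by auto
  then have "F i \<in> span ?S"
    using \<open>F i \<in> _\<close> span_mono by blast
  then have "span (insert (F i) ?S) = span ?S" by (rule span_redundant)
  moreover have "insert (F i) ?S = F ` {..<k}" using assms(2) by auto
  ultimately have "dim ?S = k" using assms(1) by (metis dim_span)
  moreover have "dim ?S \<le> card ?S" by (rule dim_le_card') simp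
  moreover have "card ?S \<le> card ({..<k} - {i})" by (rule card_image_le) simp
  ultimately show False using assms(2) by simp
qed

context riemannian_manifold
begin

section \<open>Bilinear algebra of the metric on tangent spaces\<close>

lemma metric_diff_left:
  assumes "u \<in> tangent_space A p" "v \<in> tangent_space A p" "w \<in> tangent_space A p"
  shows "g p (u - v) w = g p u w - g p v w"
proof -
  have "u - v \<in> tangent_space A p"
    using assms subspace_diff[OF subspace_tangent_space] by blast
  from metric_add[OF this assms(2,3)] show ?thesis by simp
qed

lemma metric_add_right:
  assumes "u \<in> tangent_space A p" "v \<in> tangent_space A p" "w \<in> tangent_space A p"
  shows "g p w (u + v) = g p w u + g p w v"
  using metric_add[OF assms] metric_sym assms subspace_add[OF subspace_tangent_space] by metis

lemma metric_nondegenerate: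
  assumes "u \<in> tangent_space A p" "g p u u = 0"
  shows "u = 0"
  using metric_pos[OF assms(1)] assms(2) by force

text \<open>The axioms control \<open>g p\<close> only on tangent vectors, so the orthogonal set is
  cut out inside the tangent space.\<close>

lemma subspace_orthogonal:
  assumes "v \<in> tangent_space A p"
  shows "subspace {w \<in> tangent_space A p. g p v w = 0}"
proof -
  have eq: "{w \<in> tangent_space A p. g p v w = 0} = {w \<in> tangent_space A p. g p w v = 0}"
    using metric_sym assms by auto
  note T = subspace_tangent_space[of p]
  have "g p 0 v = 0"
    using metric_scale[OF subspace_0[OF T] assms, of 0] by simp
  then show ?thesis
    unfolding eq subspace_def
    using subspace_0[OF T] subspace_add[OF T] subspace_scale[OF T] assms
    by (auto simp: metric_add metric_scale)
qed

lemma orthogonal_span: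
  assumes "v \<in> tangent_space A p" "S \<subseteq> tangent_space A p" "\<forall>w\<in>S. g p v w = 0" "w \<in> span S"
  shows "g p v w = 0"
  using span_minimal[OF _ subspace_orthogonal[OF assms(1)], of S] assms by blast

lemma subspace_orth_compl:
  assumes "D p \<subseteq> tangent_space A p"
  shows "subspace (orth_compl A g D p)"
proof -
  note T = subspace_tangent_space[of p]
  have "g p 0 w = 0" if "w \<in> D p" for w
    using metric_scale[OF subspace_0[OF T], of w 0] that assms by auto
  then show ?thesis
    unfolding orth_compl_def subspace_def
    using subspace_0[OF T] subspace_add[OF T] subspace_scale[OF T] assms
    by (auto simp: metric_add metric_scale subset_iff)
qed

text \<open>Two candidates differ by a vector of \<open>D p\<close> that is orthogonal to
  \<open>D p\<close>, hence to itself, and definiteness makes it zero. Only pointwise facts about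
  \<open>D\<close> enter, so the result serves the distribution and its orthogonal complement
  alike.\<close>

lemma orth_proj_eqI:
  assumes "D p \<subseteq> tangent_space A p" "subspace (D p)" "X p \<in> tangent_space A p"
    and "u \<in> D p" "\<And>w. w \<in> D p \<Longrightarrow> g p (X p - u) w = 0"
  shows "orth_proj g D X p = u"
  unfolding orth_proj_def
proof (rule the_equality)
  fix v
  assume v: "v \<in> D p \<and> (\<forall>w\<in>D p. g p (X p - v) w = 0)"
  have d: "u - v \<in> D p" using subspace_diff[OF assms(2)] assms(4) v by blast
  have t: "X p - v \<in> tangent_space A p" "X p - u \<in> tangent_space A p" "u - v \<in> tangent_space A p"
    using subspace_diff[OF subspace_tangent_space] assms(1,3,4) d v by blast+
  have "g p (X p - v) (u - v) = 0" "g p (X p - u) (u - v) = 0"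
    using v assms(5) d by auto
  then have "g p (u - v) (u - v) = 0"
    using metric_diff_left[OF t] by simp
  then have "u - v = 0"
    using metric_nondegenerate d assms(1) by blast
  then show "v = u" by simp
qed (use assms in auto)

text \<open>One Gram--Schmidt step: if \<open>Z\<close> is the projection of \<open>F k\<close> onto the span of the first \<open>k\<close>
  fields, then passing to \<open>k + 1\<close> fields adds the component along \<open>F k - Z\<close>.\<close>

lemma smooth_local_projection:
  fixes k :: nat
  assumes "open W" "\<forall>i<k. smooth_vfield_on A W (F i)"
    and "\<forall>q\<in>W. \<forall>i<k. F i q \<notin> span ((\<lambda>j. F j q) ` {..<i})"
    and "smooth_vfield_on A W X"
  shows "\<exists>Y. smooth_vfield_on A W Y \<and>
    (\<forall>q\<in>W. Y q \<in> span ((\<lambda>j. F j q) ` {..<k}) \<and> (\<forall>i<k. g q (X q - Y q) (F i q) = 0))"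
  using assms(2-)
proof (induction k arbitrary: X)
  case 0
  \<comment> \<open>The projection onto the zero space, written as a multiple of \<open>X\<close> so
    that its smoothness is an instance of scaling.\<close>
  have "smooth_vfield_on A W (\<lambda>p. 0 *\<^sub>R X p)"
    using smooth_vfield_on_scale[OF assms(1) smooth_fun_on_const[OF assms(1)] 0(3)] .
  moreover have "0 *\<^sub>R X q \<in> span ((\<lambda>j. F j q) ` {..<0})" for q
    unfolding scaleR_zero_left by (rule span_zero)
  ultimately show ?case by blast
next
  case (Suc k)
  let ?V = "\<lambda>q. span ((\<lambda>j. F j q) ` {..<k})"
  have F: "smooth_vfield_on A W (F i)" if "i \<le> k" for i
    using Suc.prems(1) that by simp
  \<comment> \<open>The induction hypothesis holds for every smooth field and is used twice: here
    for \<open>X\<close>, then for the new frame member \<open>F k\<close>.\<close>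
  obtain Y where Y: "smooth_vfield_on A W Y"
    "\<And>q. q \<in> W \<Longrightarrow> Y q \<in> ?V q" "\<And>q i. q \<in> W \<Longrightarrow> i < k \<Longrightarrow> g q (X q - Y q) (F i q) = 0"
    using Suc.IH[OF _ _ Suc.prems(3)] Suc.prems(1,2) less_SucI by metis
  obtain Z where Z: "smooth_vfield_on A W Z"
    "\<And>q. q \<in> W \<Longrightarrow> Z q \<in> ?V q" "\<And>q i. q \<in> W \<Longrightarrow> i < k \<Longrightarrow> g q (F k q - Z q) (F i q) = 0"
    using Suc.IH[OF _ _ F[OF order_refl]] Suc.prems(1,2) less_SucI by metis
  define E where "E = (\<lambda>q. F k q - Z q)"
  define R where "R = (\<lambda>q. X q - Y q)"
  \<comment> \<open>The Fourier coefficient of the residual \<open>R\<close> along the new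
    orthogonal direction \<open>E\<close>; the updated projection is \<open>Y + c E\<close>.\<close>
  define c where "c = (\<lambda>q. g q (R q) (E q) * inverse (g q (E q) (E q)))"
  have E: "smooth_vfield_on A W E"
    unfolding E_def by (intro smooth_vfield_on_diff assms(1) F Z(1) order_refl)
  have R: "smooth_vfield_on A W R"
    unfolding R_def by (intro smooth_vfield_on_diff assms(1) Suc.prems(3) Y(1))
  have tangent: "X q \<in> tangent_space A q" "Y q \<in> tangent_space A q" "Z q \<in> tangent_space A q"
    "E q \<in> tangent_space A q" "R q \<in> tangent_space A q"
    "\<And>i. i \<le> k \<Longrightarrow> F i q \<in> tangent_space A q" if "q \<in> W" for q
    using that Suc.prems(3) Y(1) Z(1) E R F unfolding smooth_vfield_on_def by blast+
  \<comment> \<open>A null \<open>E q\<close> would put \<open>F k q\<close> into the span of its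
    predecessors. Hence the division in \<open>c\<close> is smooth on all of
    \<open>W\<close>.\<close>
  have nz: "g q (E q) (E q) \<noteq> 0" if "q \<in> W" for q
  proof
    assume "g q (E q) (E q) = 0"
    then have "F k q = Z q"
      using metric_nondegenerate[OF tangent(4)[OF that]] by (simp add: E_def)
    then show False using Z(2)[OF that] Suc.prems(2) that lessI by metis
  qed
  have "smooth_fun_on A W c"
    unfolding c_def
    using assms(1) E R nz by (intro smooth_fun_on_mult smooth_fun_on_inverse metric_smooth)
  then have smooth: "smooth_vfield_on A W (\<lambda>q. Y q + c q *\<^sub>R E q)"
    by (intro smooth_vfield_on_add smooth_vfield_on_scale assms(1) Y(1) E)
  have span: "Y q + c q *\<^sub>R E q \<in> span ((\<lambda>j. F j q) ` {..<Suc k})" if "q \<in> W" for q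
  proof -
    have "?V q \<subseteq> span ((\<lambda>j. F j q) ` {..<Suc k})" by (intro span_mono) auto
    then show ?thesis
      unfolding E_def
      by (intro span_add span_scale span_diff) (use Y(2) Z(2) that in \<open>auto intro: span_base\<close>)
  qed
  have "g q (X q - (Y q + c q *\<^sub>R E q)) (F i q) = 0" if q: "q \<in> W" and i: "i < Suc k" for q i
  proof -
    note t = tangent[OF q]
    have cE: "c q *\<^sub>R E q \<in> tangent_space A q"
      using subspace_scale[OF subspace_tangent_space t(4)] .
    have S: "(\<lambda>j. F j q) ` {..<k} \<subseteq> tangent_space A q" using t(6) by auto
    have split: "g q (X q - (Y q + c q *\<^sub>R E q)) w = g q (R q) w - c q * g q (E q) w"
      if "w \<in> tangent_space A q" for w
      using metric_diff_left[OF t(5) cE that] metric_scale[OF t(4) that]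
      by (simp add: R_def diff_diff_eq)
    have orth: "g q (R q) w = 0" "g q (E q) w = 0" if "w \<in> ?V q" for w
      using orthogonal_span[OF t(5) S _ that] orthogonal_span[OF t(4) S _ that] Y(3) Z(3) q
      by (auto simp: R_def E_def)
    show ?thesis
    proof (cases "i = k")
      case False
      then have "F i q \<in> ?V q" using i by (auto intro: span_base)
      then show ?thesis using split[OF t(6)] orth i by simp
    next
      case True
      \<comment> \<open>\<open>Z q\<close> lies in the old span, to which \<open>R q\<close> and
        \<open>E q\<close> are both orthogonal; only the pairings with \<open>E q\<close> remain,
        and \<open>c\<close> was chosen to cancel them.\<close>
      have Fk: "F k q = E q + Z q" by (simp add: E_def)
      have "g q (X q - (Y q + c q *\<^sub>R E q)) (F k q) = g q (R q) (E q) - c q * g q (E q) (E q)"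
        unfolding split[OF t(6)[OF order_refl]]
        using metric_add_right[OF t(4,3,5)] metric_add_right[OF t(4,3,4)] orth[OF Z(2)[OF q]]
        by (simp add: Fk)
      also have "\<dots> = 0" using nz[OF q] by (simp add: c_def)
      finally show ?thesis using True by simp
    qed
  qed
  with smooth span show ?case by blast
qed

text \<open>Gram-Schmidt on a local frame, with orthogonality extended from the frame to the fibre
  it spans. The field \<open>Y\<close> provides both existence of the projection at each point of
  \<open>W\<close> and its smoothness there.\<close>

lemma orth_proj_local:
  assumes D: "regular_distribution A k D" and X: "X \<in> vfields A"
  shows "\<exists>W Y. open W \<and> p \<in> W \<and> smooth_vfield_on A W Y \<and>
    (\<forall>q\<in>W. Y q \<in> D q \<and> (\<forall>w\<in>D q. g q (X q - Y q) w = 0))"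
proof -
  have "\<exists>W F. open W \<and> p \<in> W \<and> (\<forall>i<k. smooth_vfield_on A W (F i)) \<and>
      (\<forall>q\<in>W. span ((\<lambda>i. F i q) ` {..<k}) = D q)"
    by (rule D[unfolded regular_distribution_def, THEN conjunct2, THEN spec])
  then obtain W F where W: "open W" "p \<in> W" "\<forall>i<k. smooth_vfield_on A W (F i)"
    and span: "\<forall>q\<in>W. span ((\<lambda>i. F i q) ` {..<k}) = D q"
    by (elim exE conjE)
  have XT: "X q \<in> tangent_space A q" for q
    using vfields_tangent[OF X] .
  have XW: "smooth_vfield_on A W X"
    by (rule smooth_vfield_on_subset[OF subset_UNIV]) (use X in \<open>simp add: vfields_def\<close>)
  have ind: "\<forall>q\<in>W. \<forall>i<k. F i q \<notin> span ((\<lambda>j. F j q) ` {..<i})"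
  proof (intro ballI allI impI)
    fix q i
    assume "q \<in> W" "i < k"
    moreover have "dim (span ((\<lambda>j. F j q) ` {..<k})) = k"
      using span regular_distributionD(3)[OF D] \<open>q \<in> W\<close> by simp
    ultimately show "F i q \<notin> span ((\<lambda>j. F j q) ` {..<i})"
      using spanning_family_independent[of "\<lambda>j. F j q"] by blast
  qed
  obtain Y where Y: "smooth_vfield_on A W Y"
    "\<forall>q\<in>W. Y q \<in> span ((\<lambda>j. F j q) ` {..<k}) \<and> (\<forall>i<k. g q (X q - Y q) (F i q) = 0)"
    using smooth_local_projection[OF W(1,3) ind XW] by (elim exE conjE)
  have "g q (X q - Y q) w = 0" if "q \<in> W" "w \<in> D q" for q w
  proof (rule orthogonal_span)
    show "w \<in> span ((\<lambda>i. F i q) ` {..<k})" using that span by simp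
    show "X q - Y q \<in> tangent_space A q"
      using that Y(1) by (intro subspace_diff subspace_tangent_space XT)
        (auto simp: smooth_vfield_on_def)
    show "(\<lambda>i. F i q) ` {..<k} \<subseteq> tangent_space A q"
      using that W(3) by (auto simp: smooth_vfield_on_def)
    show "\<forall>w\<in>(\<lambda>i. F i q) ` {..<k}. g q (X q - Y q) w = 0"
      using that Y(2) by blast
  qed
  moreover have "Y q \<in> D q" if "q \<in> W" for q
    using Y(2) span that by blast
  ultimately show ?thesis using W(1,2) Y(1) by (intro exI[of _ W] exI[of _ Y] conjI ballI)
qed

text \<open>Uniqueness identifies \<open>orth_proj\<close> with each local field \<open>Y\<close>,
  whichever frame produced it. The pointwise properties are inherited from \<open>Y\<close>, and
  smoothness follows because it is local.\<close>

lemma orth_proj_props: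
  assumes D: "regular_distribution A k D" and X: "X \<in> vfields A"
  shows "orth_proj g D X p \<in> D p"
    and "w \<in> D p \<Longrightarrow> g p (X p - orth_proj g D X p) w = 0"
    and "orth_proj g D X \<in> vfields A"
proof -
  have eqI: "orth_proj g D X q = u" if "u \<in> D q" "\<forall>w\<in>D q. g q (X q - u) w = 0" for q u
    using orth_proj_eqI[where X = X and D = D and p = q, OF regular_distributionD(1,2)[OF D, of q]
        vfields_tangent[OF X] that(1)] that(2) by blast
  have local: "\<exists>W Y. open W \<and> q \<in> W \<and> smooth_vfield_on A W Y \<and> (\<forall>r\<in>W. orth_proj g D X r = Y r)"
    and mem: "orth_proj g D X q \<in> D q \<and> (\<forall>w\<in>D q. g q (X q - orth_proj g D X q) w = 0)" for q
  proof -
    obtain W Y where W: "open W" "q \<in> W" "smooth_vfield_on A W Y"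
      and Y: "\<forall>r\<in>W. Y r \<in> D r \<and> (\<forall>w\<in>D r. g r (X r - Y r) w = 0)"
      using orth_proj_local[OF D X, of q] by (elim exE conjE)
    have eq: "\<forall>r\<in>W. orth_proj g D X r = Y r"
      using Y eqI by blast
    show "\<exists>W Y. open W \<and> q \<in> W \<and> smooth_vfield_on A W Y \<and> (\<forall>r\<in>W. orth_proj g D X r = Y r)"
      using W eq by (intro exI[of _ W] exI[of _ Y] conjI)
    show "orth_proj g D X q \<in> D q \<and> (\<forall>w\<in>D q. g q (X q - orth_proj g D X q) w = 0)"
      using bspec[OF Y W(2)] unfolding bspec[OF eq W(2)] .
  qed
  show "orth_proj g D X p \<in> D p"
    and "w \<in> D p \<Longrightarrow> g p (X p - orth_proj g D X p) w = 0"
    using mem by blast+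
  show "orth_proj g D X \<in> vfields A"
    by (rule vfields_locally) (rule local)
qed

text \<open>The remainder \<open>X - orth_proj g D X\<close> is normal, and what it leaves of
  \<open>X\<close> lies in \<open>D\<close>, orthogonal to the complement by symmetry. Smoothness of
  the normal projection then comes by subtraction, without a frame for the complement.\<close>

lemma orth_proj_orth_compl:
  assumes D: "regular_distribution A k D" and X: "X \<in> vfields A"
  shows "orth_proj g (orth_compl A g D) X = X - orth_proj g D X"
proof
  fix p
  note P = orth_proj_props[OF D X] and DT = regular_distributionD(1)[OF D, of p]
  have "g p (X p - (X p - orth_proj g D X p)) w = 0" if "w \<in> orth_compl A g D p" for w
    using that P(1)[of p] DT metric_sym[of w p "orth_proj g D X p"]
    by (auto simp: orth_compl_def)
  moreover have "X p - orth_proj g D X p \<in> orth_compl A g D p"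
    unfolding orth_compl_def
    using P(2) vfields_tangent[OF vfields_diff[OF X P(3)], of p] by simp
  moreover have "orth_compl A g D p \<subseteq> tangent_space A p" by (auto simp: orth_compl_def)
  ultimately show "orth_proj g (orth_compl A g D) X p = (X - orth_proj g D X) p"
    using orth_proj_eqI[where D = "orth_compl A g D" and X = X and p = p]
      subspace_orth_compl[where D = D, OF DT] vfields_tangent[OF X] by simp
qed

text \<open>The discarded part is normal to \<open>w\<close>; this removes or inserts a projection
  whenever the other argument lies in \<open>D\<close>.\<close>

lemma metric_orth_proj:
  assumes "regular_distribution A k D" "X \<in> vfields A" "w \<in> D p"
  shows "g p (orth_proj g D X p) w = g p (X p) w"
  using orth_proj_props(2)[OF assms] metric_diff_left[of "X p" p "orth_proj g D X p" w]
    vfields_tangent assms orth_proj_props(3)[OF assms(1,2)] regular_distributionD(1)[OF assms(1)]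
  by (smt (verit) subsetD)

lemma metric_orth_compl:
  assumes "regular_distribution A k D" "X \<in> vfields A" "w \<in> D p"
  shows "g p (orth_proj g (orth_compl A g D) X p) w = 0"
  using orth_proj_props(2)[OF assms] by (simp add: orth_proj_orth_compl[OF assms(1,2)])

lemma orth_proj_add_orth_compl:
  assumes "regular_distribution A k D" "X \<in> vfields A"
  shows "orth_proj g D X + orth_proj g (orth_compl A g D) X = X"
  by (simp add: orth_proj_orth_compl[OF assms])

lemma orth_proj_orth_compl_vfield:
  assumes "regular_distribution A k D" "X \<in> vfields A"
  shows "orth_proj g (orth_compl A g D) X \<in> vfields A"
  unfolding orth_proj_orth_compl[OF assms]
  by (intro vfields_diff orth_proj_props(3)[OF assms] assms(2))

end

section \<open>The Gauss equation\<close>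

locale riemannian_distribution =
  riemannian_manifold A g + levi_civita A g nabla
  for A :: "('m::{t2_space, second_countable_topology}, 'e::real_normed_vector) atlas"
    and g :: "'m metric" and nabla :: "'m vfield \<Rightarrow> 'm vfield \<Rightarrow> 'm vfield" +
  fixes D :: "'m \<Rightarrow> 'm tangent set" and k :: nat
  assumes D: "regular_distribution A k D"
begin

abbreviation B :: "'m vfield \<Rightarrow> 'm vfield \<Rightarrow> 'm vfield" where
  "B \<equiv> second_fund_form A g nabla D"

section \<open>Tangential and normal parts of the Levi-Civita connection\<close>

lemma sections_vfields: "X \<in> sections A D \<Longrightarrow> X \<in> vfields A"
  and sections_mem: "X \<in> sections A D \<Longrightarrow> X p \<in> D p"
  by (auto simp: sections_def)

lemma second_fund_form_vfield:
  "X \<in> vfields A \<Longrightarrow> Y \<in> vfields A \<Longrightarrow> B X Y \<in> vfields A"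
  unfolding second_fund_form_def by (intro orth_proj_orth_compl_vfield[OF D] conn_closed)

lemma dist_conn_vfield:
  "X \<in> vfields A \<Longrightarrow> Y \<in> vfields A \<Longrightarrow> dist_conn g nabla D X Y \<in> vfields A"
  unfolding dist_conn_def by (intro orth_proj_props(3)[OF D] conn_closed)

lemma conn_split:
  "X \<in> vfields A \<Longrightarrow> Y \<in> vfields A \<Longrightarrow> nabla X Y = dist_conn g nabla D X Y + B X Y"
  unfolding dist_conn_def second_fund_form_def
  by (rule orth_proj_add_orth_compl[OF D conn_closed, symmetric])

text \<open>A Weingarten identity: metric compatibility moves the derivative from the normal field
  \<open>B Y Z\<close> to \<open>W\<close>, with a change of sign, and only the normal part of
  \<open>nabla X W\<close> pairs nontrivially with \<open>B Y Z\<close>.\<close>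

lemma metric_conn_second_fund_form:
  assumes "X \<in> vfields A" "Y \<in> vfields A" "Z \<in> vfields A" "W \<in> sections A D"
  shows "g p (nabla X (B Y Z) p) (W p) = - g p (B Y Z p) (B X W p)"
proof -
  note W = sections_vfields[OF assms(4)] and BYZ = second_fund_form_vfield[OF assms(2,3)]
  have orth: "g q (B Y Z q) w = 0" if "w \<in> D q" for q w
    unfolding second_fund_form_def
    by (rule metric_orth_compl[OF D conn_closed[OF assms(2,3)] that])
  have "X p (\<lambda>q. g q (B Y Z q) (W q)) = 0"
    using tangent_zero_fun[OF vfields_tangent[OF assms(1)]]
    by (simp add: orth sections_mem[OF assms(4)])
  then have "g p (nabla X (B Y Z) p) (W p) = - g p (B Y Z p) (nabla X W p)"
    using metric_compatible[OF assms(1) BYZ W, of p] by simp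
  also have "nabla X W p = dist_conn g nabla D X W p + B X W p"
    by (simp add: conn_split[OF assms(1) W])
  also have "g p (B Y Z p) \<dots> = g p (B Y Z p) (B X W p)"
    using metric_add_right[OF vfields_tangent vfields_tangent vfields_tangent, of _ _ _ p]
      dist_conn_vfield[OF assms(1) W] second_fund_form_vfield[OF assms(1) W] BYZ
      orth[OF orth_proj_props(1)[OF D conn_closed[OF assms(1) W]]]
    by (simp add: dist_conn_def)
  finally show ?thesis .
qed

text \<open>Pairing with \<open>W\<close> absorbs the outer projection. Undoing the inner one costs
  the term with \<open>nabla X (B Y Z)\<close>, which the Weingarten identity evaluates.
  Antisymmetrizing in \<open>X\<close> and \<open>Y\<close> yields both quadratic terms of the Gauss
  equation.\<close>

lemma metric_iterated_dist_conn:
  assumes "X \<in> vfields A" "Y \<in> vfields A" "Z \<in> vfields A" "W \<in> sections A D"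
  shows "g p (dist_conn g nabla D X (dist_conn g nabla D Y Z) p) (W p) =
    g p (nabla X (nabla Y Z) p) (W p) + g p (B Y Z p) (B X W p)"
proof -
  note dYZ = dist_conn_vfield[OF assms(2,3)] and BYZ = second_fund_form_vfield[OF assms(2,3)]
  note W = sections_vfields[OF assms(4)]
  have "g p (dist_conn g nabla D X (dist_conn g nabla D Y Z) p) (W p) =
      g p (nabla X (dist_conn g nabla D Y Z) p) (W p)"
    unfolding dist_conn_def[of g nabla D X]
    by (rule metric_orth_proj[OF D conn_closed[OF assms(1) dYZ] sections_mem[OF assms(4)]])
  moreover have "nabla X (nabla Y Z) = nabla X (dist_conn g nabla D Y Z) + nabla X (B Y Z)"
    using conn_add_right[OF assms(1) dYZ BYZ] by (simp add: conn_split[OF assms(2,3)])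
  then have "g p (nabla X (nabla Y Z) p) (W p) =
      g p (nabla X (dist_conn g nabla D Y Z) p) (W p) + g p (nabla X (B Y Z) p) (W p)"
    by (simp add: metric_add vfields_tangent conn_closed dYZ BYZ W assms)
  ultimately show ?thesis
    using metric_conn_second_fund_form[OF assms] by simp
qed

lemma gauss_equation:
  assumes "X1 \<in> sections A D" "X2 \<in> sections A D" "X3 \<in> sections A D" "X4 \<in> sections A D"
  shows "dist_curvature g nabla D X1 X2 X3 X4 p =
      curvature g nabla X1 X2 X3 X4 p - g p (B X1 X3 p) (B X2 X4 p) + g p (B X2 X3 p) (B X1 X4 p)
      + g p (orth_proj g D (nabla (orth_proj g (orth_compl A g D) (lie_bracket X1 X2)) X3) p) (X4 p)"
proof -
  note X = assms[THEN sections_vfields] and X4 = sections_mem[OF assms(4)]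
  let ?L = "lie_bracket X1 X2"
  let ?P = "orth_proj g D ?L" and ?N = "orth_proj g (orth_compl A g D) ?L"
  \<comment> \<open>Torsion-freeness writes the bracket as a difference of two covariant
    derivatives, so its smoothness comes from that of the connection.\<close>
  have L: "?L \<in> vfields A"
    using vfields_diff[OF conn_closed[OF X(1,2)] conn_closed[OF X(2,1)]]
    by (simp add: torsion_free[OF X(1,2)])
  note P = orth_proj_props(3)[OF D L] and N = orth_proj_orth_compl_vfield[OF D L]
  have "nabla ?L X3 = nabla ?P X3 + nabla ?N X3"
    using conn_add_left[OF P N X(3)] by (simp add: orth_proj_add_orth_compl[OF D L])
  then have "g p (nabla ?L X3 p) (X4 p) = g p (nabla ?P X3 p) (X4 p) + g p (nabla ?N X3 p) (X4 p)"
    by (simp add: metric_add vfields_tangent conn_closed P N X)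
  also have "\<dots> = g p (dist_conn g nabla D ?P X3 p) (X4 p)
      + g p (orth_proj g D (nabla ?N X3) p) (X4 p)"
    unfolding dist_conn_def
    using metric_orth_proj[OF D conn_closed[OF P X(3)] X4]
      metric_orth_proj[OF D conn_closed[OF N X(3)] X4] by simp
  \<comment> \<open>\<open>curvature\<close> differentiates along the full bracket,
    \<open>dist_curvature\<close> only along its tangential part. As both terms are subtracted, the
    normal part appears with a plus sign in the result.\<close>
  finally have bracket: "g p (nabla ?L X3 p) (X4 p) = \<dots>" .
  have diff: "g p ((U - V - W) p) (X4 p) = g p (U p) (X4 p) - g p (V p) (X4 p) - g p (W p) (X4 p)"
    if "U \<in> vfields A" "V \<in> vfields A" "W \<in> vfields A" for U V W
    using metric_diff_left[OF vfields_tangent[OF vfields_diff[OF that(1,2)]]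
        vfields_tangent[OF that(3)] vfields_tangent[OF X(4)], of p]
      metric_diff_left[OF that(1,2)[THEN vfields_tangent] vfields_tangent[OF X(4)], of p]
    by simp
  show ?thesis
    unfolding dist_curvature_def curvature_def
    by (simp only: diff conn_closed dist_conn_vfield L P X bracket
        metric_iterated_dist_conn[OF X(1,2,3) assms(4)]
        metric_iterated_dist_conn[OF X(2,1,3) assms(4)])
qed

end

theorem theorem24:
  fixes A :: "('m::{t2_space, second_countable_topology}, 'e::real_normed_vector) atlas"
    and g :: "'m metric"
    and nabla :: "'m vfield \<Rightarrow> 'm vfield \<Rightarrow> 'm vfield"
    and D :: "'m \<Rightarrow> 'm tangent set"
    and k :: nat
    and X1 X2 X3 X4 :: "'m vfield"
    and p :: 'm
  assumes "riemannian_manifold A g"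
    and "levi_civita A g nabla"
    and "regular_distribution A k D"
    and "X1 \<in> sections A D" "X2 \<in> sections A D" "X3 \<in> sections A D" "X4 \<in> sections A D"
  shows "dist_curvature g nabla D X1 X2 X3 X4 p =
      curvature g nabla X1 X2 X3 X4 p
      - g p (second_fund_form A g nabla D X1 X3 p) (second_fund_form A g nabla D X2 X4 p)
      + g p (second_fund_form A g nabla D X2 X3 p) (second_fund_form A g nabla D X1 X4 p)
      + g p (orth_proj g D (nabla (orth_proj g (orth_compl A g D) (lie_bracket X1 X2)) X3) p) (X4 p)"
proof -
  interpret riemannian_distribution A g nabla D k
    using assms(1-3) by (intro riemannian_distribution.intro riemannian_distribution_axioms.intro)
  show ?thesis using gauss_equation assms(4-7) .
qed

end
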